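(* Let $\mu,m\in[0,1]$ with $m\ne\mu$, let $\alpha\in(0,1)$ and $c>1/4$. Let $\mathcal{P}(\mu)$ be the set of all probability distributions on $[0,1]$ with mean $\mu$, and suppose $X_1,X_2,\dots$ are i.i.d. from some $P\in\mathcal{P}(\mu)$. Then: (i) the capital process satisfies $K_t(m)\to\infty$ almost surely as $t\to\infty$ (for every $P\in\mathcal{P}(\mu)$); (ii) the sequential test $T_t(m,\alpha)=\mathbf{1}[\exists i\le t:\ K_i(m)\ge 1/\alpha]$ is a test of power one, i.e. $$\inf_{P\in\mathcal{P}(\mu)}P\big(\exists t<\infty:\ T_t(m,\alpha)=1\big)=1.$$
   Context: Single data stream: $X_1,X_2,\dots\in[0,1]$. For $m\in[0,1]$ and a constant $c$, put $\hat\mu_0=m$ and $\hat\mu_{i-1}=\frac{1}{i-1}\sum_{j=1}^{i-1}X_j$ for $i>1$. The capital process is $$K_t(m)=\prod_{i=1}^t\left(1+\frac{(\hat\mu_{i-1}-m)(X_i-m)}{c}\right).$$ In (ii), $P(\cdot)$ denotes probability when the observations are i.i.d. from $P$. *)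

theory Defs
  imports "HOL-Probability.Probability"
begin

(* Streams are indexed by the positive integers: only x 1, x 2, ... are used,
   the value x 0 is irrelevant. *)

definition mu_hat :: "real \<Rightarrow> (nat \<Rightarrow> real) \<Rightarrow> nat \<Rightarrow> real" where
  "mu_hat m x n = (if n = 0 then m else (\<Sum>j=1..n. x j) / real n)"

definition capital :: "real \<Rightarrow> real \<Rightarrow> (nat \<Rightarrow> real) \<Rightarrow> nat \<Rightarrow> real" where
  "capital c m x t = (\<Prod>i=1..t. 1 + (mu_hat m x (i - 1) - m) * (x i - m) / c)"

definition seq_test :: "real \<Rightarrow> real \<Rightarrow> real \<Rightarrow> (nat \<Rightarrow> real) \<Rightarrow> nat \<Rightarrow> nat" where
  "seq_test c m \<alpha> x t = of_bool (\<exists>i\<le>t. capital c m x i \<ge> 1 / \<alpha>)"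

(* Distributions on [0,1] are Borel probability measures on the real line that give
   [0,1] full mass; the identity is then bounded almost everywhere, hence integrable. *)
definition mean_dists :: "real \<Rightarrow> real measure set" where
  "mean_dists \<mu> = {P. prob_space P \<and> sets P = sets borel \<and> measure P {0..1} = 1 \<and>
     (\<integral>x. x \<partial>P) = \<mu>}"

definition iid_from :: "'a measure \<Rightarrow> (nat \<Rightarrow> 'a \<Rightarrow> real) \<Rightarrow> real measure \<Rightarrow> bool" where
  "iid_from M X P \<longleftrightarrow> prob_space M \<and> prob_space.indep_vars M (\<lambda>_. borel) X {1..} \<and>
     (\<forall>i\<ge>1. distr M borel (X i) = P)"

(* The law of an i.i.d. sequence from P on the canonical space of streams. *)
definition iid_law :: "real measure \<Rightarrow> (nat \<Rightarrow> real) measure" where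
  "iid_law P = PiM {1..} (\<lambda>_. P)"

end

theory Submission
  imports Defs
begin

text \<open>
  Round \<open>i\<close> multiplies the capital by \<open>1 + l\<^sub>i (X\<^sub>i - m)\<close>, where the bet is
  \<open>l\<^sub>i = (mu_hat\<^sub>i\<^sub>-\<^sub>1 - m) / c\<close>. By concavity the logarithm of this factor is at least the
  affine interpolation in \<open>X\<^sub>i\<close> of its values at \<open>X\<^sub>i = 0\<close> and \<open>X\<^sub>i = 1\<close>. As the empirical
  mean converges to \<open>\<mu>\<close> almost surely, the bets converge to \<open>(\<mu> - m) / c\<close>, and the average of
  these lower bounds converges to the logarithmic growth rate of this limiting bet against a
  Bernoulli distribution with mean \<open>\<mu>\<close>. The rate is positive because \<open>c > 1 / 4 \<ge> m (1 - m)\<close>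
  makes the limiting bet a proper fraction of the Kelly bet \<open>(\<mu> - m) / (m (1 - m))\<close> (infinite
  if \<open>m\<close> is \<open>0\<close> or \<open>1\<close>). Only the law of large numbers is probabilistic; for bounded variables
  it follows from Hoeffding's inequality and the Borel-Cantelli lemma.
\<close>

section \<open>A strong law of large numbers for bounded variables\<close>

lemma (in prob_space) bounded_strong_law:
  fixes X :: "nat \<Rightarrow> 'a \<Rightarrow> real"
  assumes indep: "indep_vars (\<lambda>_. borel) X {1..}"
    and distr: "\<And>i. i \<ge> 1 \<Longrightarrow> distr M borel (X i) = distr M borel (X 1)"
    and bounded: "AE \<omega> in M. X 1 \<omega> \<in> {a..b}" and "a < b"
  shows "AE \<omega> in M. (\<lambda>n. (\<Sum>i=1..n. X i \<omega>) / real n) \<longlonglongrightarrow> expectation (X 1)"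
proof -
  define avg where "avg = (\<lambda>n \<omega>. (\<Sum>i=1..n. X i \<omega>) / real n)"
  have rv: "X i \<in> borel_measurable M" if "i \<ge> 1" for i
    using indep that by (auto simp: indep_vars_def)
  have [measurable]: "avg n \<in> borel_measurable M" for n
    unfolding avg_def using rv by (intro borel_measurable_divide borel_measurable_sum) auto
  have conv: "AE \<omega> in M. \<forall>\<^sub>F n in sequentially. \<bar>avg n \<omega> - expectation (X 1)\<bar> < \<epsilon>"
    if "\<epsilon> > 0" for \<epsilon>
  proof -
    define A where "A = (\<lambda>n. {\<omega> \<in> space M. \<bar>avg n \<omega> - expectation (X 1)\<bar> \<ge> \<epsilon>})"
    \<comment> \<open>Hoeffding's bound at time \<open>n\<close> is geometric in \<open>n\<close>
      with ratio \<open>q\<close>, which makes the deviation probabilities summable.\<close>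
    define q where "q = exp (-2 * \<epsilon>\<^sup>2 / (b - a)\<^sup>2)"
    have [measurable]: "A n \<in> sets M" for n
      unfolding A_def by measurable
    have le: "prob (A n) \<le> 2 * q ^ n" if "n \<ge> 1" for n
    proof -
      interpret H: Hoeffding_ineq_iid M "{1..n}" X "X 1" a b "expectation (X 1)"
      proof unfold_locales
        show "indep_vars (\<lambda>_. borel) X {1..n}"
          by (rule indep_vars_subset[OF indep]) auto
        show "distr M borel (X i) = distr M borel (X 1)" if "i \<in> {1..n}" for i
          using that by (intro distr) auto
      qed (use rv bounded in auto)
      have "prob (A n) \<le> 2 * exp (-2 * real n * \<epsilon>\<^sup>2 / (b - a)\<^sup>2)"
        using H.Hoeffding_ineq_abs_ge'[OF less_imp_le[OF \<open>\<epsilon> > 0\<close>] \<open>a < b\<close>] \<open>n \<ge> 1\<close>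
        by (simp add: A_def avg_def del: H.expectation_X)
      also have "exp (-2 * real n * \<epsilon>\<^sup>2 / (b - a)\<^sup>2) = q ^ n"
        by (simp add: q_def exp_of_nat_mult[symmetric] mult_ac)
      finally show ?thesis .
    qed
    have "\<bar>q\<bar> < 1"
      using \<open>\<epsilon> > 0\<close> \<open>a < b\<close> by (simp add: q_def)
    hence "summable (\<lambda>n. 2 * q ^ n)"
      by (intro summable_mult summable_geometric) simp
    hence "summable (\<lambda>n. prob (A n))"
      by (rule summable_comparison_test'[where N = 1]) (use le in auto)
    hence "AE \<omega> in M. \<forall>\<^sub>F n in sequentially. \<omega> \<in> space M - A n"
      by (intro borel_cantelli_AE1) (auto simp: emeasure_eq_measure)
    thus ?thesis
      by eventually_elim (auto simp: A_def elim!: eventually_mono)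
  qed
  \<comment> \<open>The exceptional null set depends on the tolerance, so only the countably many
    tolerances \<open>1 / Suc k\<close> are intersected.\<close>
  have "AE \<omega> in M. \<forall>k. \<forall>\<^sub>F n in sequentially.
          \<bar>avg n \<omega> - expectation (X 1)\<bar> < 1 / real (Suc k)"
    unfolding AE_all_countable by (intro allI conv) simp
  thus ?thesis
  proof eventually_elim
    case (elim \<omega>)
    show ?case
    proof (rule tendstoI)
      fix e :: real assume "e > 0"
      then obtain k where k: "1 / real (Suc k) < e"
        using nat_approx_posE by blast
      show "\<forall>\<^sub>F n in sequentially. dist ((\<Sum>i=1..n. X i \<omega>) / real n) (expectation (X 1)) < e"
        using elim[rule_format, of k]
        by eventually_elim (use k in \<open>auto simp: avg_def dist_real_def\<close>)
    qed
  qed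
qed

section \<open>Positivity of the betting factors and of the limiting growth rate\<close>

text \<open>The product is affine in \<open>a\<close> and in \<open>b\<close> separately, so its
  minimum over the square is at a corner; the worst corners, with \<open>{a, b} = {0, 1}\<close>,
  give \<open>- m * (1 - m)\<close>.\<close>

lemma mult_diff_ge_neg_quarter:
  fixes a b m :: real
  assumes "a \<in> {0..1}" "b \<in> {0..1}" "m \<in> {0..1}"
  shows "(a - m) * (b - m) \<ge> - 1 / 4"
proof -
  have quarter: "m * (1 - m) \<le> 1 / 4"
    using zero_le_power2[of "2 * m - 1"] by (simp add: power2_eq_square algebra_simps)
  have "(a - m) * (b - m) + m * (1 - m)
      = a * b * (1 - m) + m * ((1 - a) * (1 - b))"
    by algebra
  also have "\<dots> \<ge> 0"
    using assms by (intro add_nonneg_nonneg mult_nonneg_nonneg) auto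
  finally show ?thesis using quarter by linarith
qed

text \<open>As \<open>c\<close> exceeds the worst loss \<open>1 / 4\<close>, no bet can ruin the
  player. With \<open>a\<close> an empirical mean this concerns the actual bets, with
  \<open>a = \<mu>\<close> the limiting one.\<close>

lemma bet_factor_pos:
  fixes a b c m :: real
  assumes "a \<in> {0..1}" "b \<in> {0..1}" "m \<in> {0..1}" "c > 1 / 4"
  shows "1 + (a - m) / c * (b - m) > 0"
  using mult_diff_ge_neg_quarter[OF assms(1-3)] assms(4) by (simp add: field_simps)

text \<open>Bounding both logarithms by \<open>ln y \<ge> 1 - 1 / y\<close> leaves a rational
  expression equal to \<open>l * l * (c - m * (1 - m)) / (u * v)\<close>, where \<open>u\<close> and
  \<open>v\<close> are the two factors. It is positive since \<open>l\<close> is nonzero and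
  \<open>m * (1 - m) \<le> 1 / 4 < c\<close>.\<close>

lemma kelly_growth_pos:
  fixes \<mu> m c :: real
  assumes \<mu>: "\<mu> \<in> {0..1}" and m: "m \<in> {0..1}" and "m \<noteq> \<mu>" and c: "c > 1 / 4"
  defines "l \<equiv> (\<mu> - m) / c"
  shows "\<mu> * ln (1 + l * (1 - m)) + (1 - \<mu>) * ln (1 + l * (0 - m)) > 0"
proof -
  define u v where "u = 1 + l * (1 - m)" and "v = 1 + l * (0 - m)"
  have pos: "u > 0" "v > 0"
    using bet_factor_pos[OF \<mu> _ m c, of 1] bet_factor_pos[OF \<mu> _ m c, of 0]
    by (auto simp: u_def v_def l_def)
  have ln_ge: "ln y \<ge> 1 - 1 / y" if "y > 0" for y :: real
    using ln_le_minus_one[of "1 / y"] that by (simp add: ln_div)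
  have "m * (1 - m) < c"
    using mult_diff_ge_neg_quarter[of 0 1 m] m c by (simp add: algebra_simps)
  have lc: "l * c = \<mu> - m"
    using c by (simp add: l_def)
  have "\<mu> * (1 - 1 / u) + (1 - \<mu>) * (1 - 1 / v) = l * ((\<mu> - m) - l * (m * (1 - m))) / (u * v)"
    \<comment> \<open>Denominators are cleared while \<open>u\<close> and \<open>v\<close> are still
      opaque, so that \<open>pos\<close> applies; only then are they unfolded.\<close>
    using pos by (simp add: field_simps) (simp add: u_def v_def algebra_simps)
  also have "(\<mu> - m) - l * (m * (1 - m)) = l * (c - m * (1 - m))"
    using lc by (simp add: algebra_simps)
  also have "l * (l * (c - m * (1 - m))) / (u * v) > 0"
  proof -
    have "l * l > 0"
      using \<open>m \<noteq> \<mu>\<close> c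
      by (auto simp: l_def zero_less_mult_iff linorder_neq_iff divide_less_0_iff zero_less_divide_iff)
    thus ?thesis
      using pos \<open>m * (1 - m) < c\<close> by (simp add: mult.assoc[symmetric])
  qed
  finally have "0 < \<mu> * (1 - 1 / u) + (1 - \<mu>) * (1 - 1 / v)" .
  also have "\<dots> \<le> \<mu> * ln u + (1 - \<mu>) * ln v"
    using ln_ge[OF pos(1)] ln_ge[OF pos(2)] \<mu>
    by (intro add_mono mult_left_mono) auto
  finally show ?thesis by (simp add: u_def v_def)
qed

section \<open>Growth of the capital along a fixed path\<close>

lemma mu_hat_in_unit:
  assumes "m \<in> {0..1}" and x: "\<And>i. i \<ge> 1 \<Longrightarrow> x i \<in> {0..1}"
  shows "mu_hat m x n \<in> {0..1}"
proof (cases "n = 0")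
  case False
  have "(\<Sum>j=1..n. x j) \<le> (\<Sum>j=1..n. 1)" "(\<Sum>j=1..n. x j) \<ge> 0"
    using x by (intro sum_mono sum_nonneg; simp)+
  thus ?thesis
    using False by (simp add: mu_hat_def)
qed (use assms in \<open>simp add: mu_hat_def\<close>)

text \<open>\<open>1 + l * (x - m)\<close> is the convex combination of its values at 0 and 1 with
  weights \<open>1 - x\<close> and \<open>x\<close>. The bound is affine in \<open>x\<close>, so its
  averages over data are governed by the empirical mean alone.\<close>

lemma ln_affine_ge:
  fixes l m x :: real
  assumes "x \<in> {0..1}" "1 + l * (1 - m) > 0" "1 + l * (0 - m) > 0"
  shows "x * ln (1 + l * (1 - m)) + (1 - x) * ln (1 + l * (0 - m)) \<le> ln (1 + l * (x - m))"
proof -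
  have "(1 - x) * ln (1 + l * (0 - m)) + x * ln (1 + l * (1 - m))
      \<le> ln ((1 - x) *\<^sub>R (1 + l * (0 - m)) + x *\<^sub>R (1 + l * (1 - m)))"
    using assms by (intro concave_onD[OF ln_concave]) auto
  also have "(1 - x) *\<^sub>R (1 + l * (0 - m)) + x *\<^sub>R (1 + l * (1 - m)) = 1 + l * (x - m)"
    by (simp add: algebra_simps)
  finally show ?thesis by simp
qed

text \<open>A deterministic statement about one path. From some index on, the logarithmic increments
  dominate terms \<open>y i\<close> that are affine in \<open>x i\<close> with fixed coefficients
  and whose averages tend to \<open>G / 2 > 0\<close>.\<close>

lemma capital_at_top:
  assumes \<mu>: "\<mu> \<in> {0..1}" and m: "m \<in> {0..1}" and "m \<noteq> \<mu>" and c: "c > 1 / 4"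
    and x: "\<And>i. i \<ge> 1 \<Longrightarrow> x i \<in> {0..1}"
    and lim: "(\<lambda>n. (\<Sum>i=1..n. x i) / real n) \<longlonglongrightarrow> \<mu>"
  shows "filterlim (capital c m x) at_top sequentially"
proof -
  define l where "l = (\<lambda>i. (mu_hat m x (i - 1) - m) / c)"
  define A B where "A = (\<lambda>i. ln (1 + l i * (1 - m)))" and "B = (\<lambda>i. ln (1 + l i * (0 - m)))"
  define a where "a = ln (1 + (\<mu> - m) / c * (1 - m))"
  define b where "b = ln (1 + (\<mu> - m) / c * (0 - m))"
  define G where "G = \<mu> * a + (1 - \<mu>) * b"
  have "G > 0"
    unfolding G_def a_def b_def using kelly_growth_pos[OF \<mu> m \<open>m \<noteq> \<mu>\<close> c] .
  have pos: "1 + l i * (y - m) > 0" if "y \<in> {0..1}" for i y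
    unfolding l_def by (intro bet_factor_pos mu_hat_in_unit m x that c)
  have "mu_hat m x \<longlonglongrightarrow> \<mu>"
    by (rule Lim_transform_eventually[OF lim])
       (use eventually_gt_at_top[of 0] in eventually_elim, simp add: mu_hat_def)
  hence "(\<lambda>i. mu_hat m x (i - 1)) \<longlonglongrightarrow> \<mu>"
    by (subst filterlim_sequentially_Suc[symmetric]) simp
  hence l: "l \<longlonglongrightarrow> (\<mu> - m) / c"
    unfolding l_def using c by (intro tendsto_intros) auto
  have AB: "A \<longlonglongrightarrow> a" "B \<longlonglongrightarrow> b"
    unfolding A_def B_def a_def b_def
    using bet_factor_pos[OF \<mu> _ m c, of 1] bet_factor_pos[OF \<mu> _ m c, of 0]
    by (intro tendsto_intros l less_imp_neq[symmetric]; simp)+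
  \<comment> \<open>Half of the rate \<open>G\<close> is given up to absorb the errors of
    \<open>A i\<close> and \<open>B i\<close>; the weights \<open>x i\<close> and
    \<open>1 - x i\<close> sum to 1, so the total loss per round is exactly
    \<open>G / 2\<close>.\<close>
  define y where "y = (\<lambda>i. x i * a + (1 - x i) * b - G / 2)"
  have "\<forall>\<^sub>F i in sequentially. A i > a - G / 2 \<and> B i > b - G / 2 \<and> i \<ge> 1"
    using AB \<open>G > 0\<close>
    by (intro eventually_conj order_tendstoD(1) eventually_ge_at_top) auto
  then obtain N where N: "\<And>i. i \<ge> N \<Longrightarrow> A i > a - G / 2 \<and> B i > b - G / 2 \<and> i \<ge> 1"
    by (auto simp: eventually_sequentially)
  define g where "g = (\<lambda>i. ln (1 + l i * (x i - m)))"
  have gy: "y i \<le> g i" if "i \<ge> N" for i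
  proof -
    have "y i = x i * (a - G / 2) + (1 - x i) * (b - G / 2)"
      by (simp add: y_def field_simps)
    also have "\<dots> \<le> x i * A i + (1 - x i) * B i"
      using N[OF that] x[of i] by (intro add_mono mult_left_mono) auto
    also have "\<dots> \<le> g i"
      unfolding A_def B_def g_def using N[OF that] x[of i] by (intro ln_affine_ge pos) auto
    finally show ?thesis .
  qed
  have ln_capital: "ln (capital c m x t) = (\<Sum>i=1..t. g i)" for t
  proof -
    have "ln (capital c m x t) = ln (\<Prod>i=1..t. 1 + l i * (x i - m))"
      by (simp add: capital_def l_def)
    also have "\<dots> = (\<Sum>i=1..t. g i)"
      unfolding g_def
    proof (rule ln_prod)
      show "1 + l i * (x i - m) \<noteq> 0" if "i \<in> {1..t}" for i
        using pos[OF x, of i i] that by auto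
    qed simp
    finally show ?thesis .
  qed
  \<comment> \<open>\<open>C\<close> accounts for the rounds up to \<open>N\<close>, where
    \<open>y i \<le> g i\<close> may fail; later differences are nonnegative and can only raise the
    sum.\<close>
  define C where "C = (\<Sum>i=1..N. g i - y i)"
  have lower: "(\<Sum>i=1..t. g i) \<ge> C + (\<Sum>i=1..t. y i)" if "t \<ge> N" for t
  proof -
    have "C \<le> (\<Sum>i=1..t. g i - y i)"
      unfolding C_def by (rule sum_mono2) (use that gy in auto)
    thus ?thesis by (simp add: sum_subtractf)
  qed
  have sum_y: "(\<Sum>i=1..t. y i) = real t * ((\<Sum>i=1..t. x i) / real t * (a - b) + b - G / 2)"
    if "t \<ge> 1" for t
  proof -
    have "(\<Sum>i=1..t. y i) = (\<Sum>i=1..t. x i * (a - b) + (b - G / 2))"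
      by (intro sum.cong) (auto simp: y_def algebra_simps)
    also have "\<dots> = (\<Sum>i=1..t. x i) * (a - b) + real t * (b - G / 2)"
      by (simp add: sum.distrib sum_distrib_right)
    also have "\<dots> = real t * ((\<Sum>i=1..t. x i) / real t * (a - b) + b - G / 2)"
      using that by (simp add: field_simps)
    finally show ?thesis .
  qed
  have "(\<lambda>t. (\<Sum>i=1..t. x i) / real t * (a - b) + b - G / 2) \<longlonglongrightarrow> \<mu> * (a - b) + b - G / 2"
    by (intro tendsto_intros lim)
  moreover have "\<mu> * (a - b) + b - G / 2 > 0"
    using \<open>G > 0\<close> by (simp add: G_def field_simps)
  ultimately have "filterlim (\<lambda>t. ((\<Sum>i=1..t. x i) / real t * (a - b) + b - G / 2) * real t) at_top sequentially"
    by (rule filterlim_tendsto_pos_mult_at_top[OF _ _ filterlim_real_sequentially])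
  hence "filterlim (\<lambda>t. C + ((\<Sum>i=1..t. x i) / real t * (a - b) + b - G / 2) * real t) at_top sequentially"
    by (rule filterlim_tendsto_add_at_top[OF tendsto_const])
  moreover have "\<forall>\<^sub>F t in sequentially.
      C + ((\<Sum>i=1..t. x i) / real t * (a - b) + b - G / 2) * real t \<le> ln (capital c m x t)"
    using eventually_ge_at_top[of "max 1 N"]
  proof eventually_elim
    case (elim t)
    thus ?case
      using lower[of t] sum_y[of t] by (simp only: ln_capital mult.commute max.bounded_iff)
  qed
  ultimately have "filterlim (\<lambda>t. ln (capital c m x t)) at_top sequentially"
    by (rule filterlim_at_top_mono)
  hence "filterlim (\<lambda>t. exp (ln (capital c m x t))) at_top sequentially"
    by (rule filterlim_compose[OF exp_at_top])
  \<comment> \<open>Positivity is what allows \<open>exp (ln K) = K\<close> for the capital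
    \<open>K\<close>.\<close>
  moreover have "capital c m x t > 0" for t
    unfolding capital_def using pos x by (intro prod_pos) (auto simp: l_def)
  ultimately show ?thesis by simp
qed

section \<open>Almost sure divergence for i.i.d. data and the canonical stream space\<close>

text \<open>The probability space is arbitrary, so that the result yields (i) directly and also
  applies to the coordinate process for (ii).\<close>

lemma iid_capital_at_top:
  assumes \<mu>: "\<mu> \<in> {0..1}" and m: "m \<in> {0..1}" and "m \<noteq> \<mu>" and c: "c > 1 / 4"
    and P: "P \<in> mean_dists \<mu>" and iid: "iid_from M X P"
  shows "AE \<omega> in M. filterlim (capital c m (\<lambda>i. X i \<omega>)) at_top sequentially"
proof -
  interpret prob_space M using iid by (simp add: iid_from_def)
  interpret P: prob_space P using P by (simp add: mean_dists_def)
  have indep: "indep_vars (\<lambda>_. borel) X {1..}"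
    and distr: "\<And>i. i \<ge> 1 \<Longrightarrow> distr M borel (X i) = P"
    using iid by (auto simp: iid_from_def)
  have rv: "X i \<in> borel_measurable M" if "i \<ge> 1" for i
    using indep that by (auto simp: indep_vars_def)
  have "AE y in P. y \<in> {0..1}"
    using P by (intro P.AE_prob_1) (simp add: mean_dists_def)
  hence unit: "AE \<omega> in M. X i \<omega> \<in> {0..1}" if "i \<ge> 1" for i
    using AE_distrD[OF rv[OF that], of "\<lambda>y. y \<in> {0..1}"] unfolding distr[OF that] by blast
  have "expectation (X 1) = (\<integral>y. y \<partial>distr M borel (X 1))"
    using rv by (subst integral_distr) auto
  also have "\<dots> = \<mu>"
    using distr P by (simp add: mean_dists_def)
  finally have "expectation (X 1) = \<mu>" .
  hence "AE \<omega> in M. (\<lambda>n. (\<Sum>i=1..n. X i \<omega>) / real n) \<longlonglongrightarrow> \<mu>"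
    using bounded_strong_law[OF indep _ unit[OF order_refl] zero_less_one] distr
    by (simp only: order_refl)
  moreover have "AE \<omega> in M. \<forall>i. i \<ge> 1 \<longrightarrow> X i \<omega> \<in> {0..1}"
    unfolding AE_all_countable using unit by (auto intro: AE_I2)
  ultimately show ?thesis
    by eventually_elim (use \<mu> m \<open>m \<noteq> \<mu>\<close> c in \<open>auto intro!: capital_at_top\<close>)
qed

lemma iid_from_iid_law:
  assumes "prob_space P" and sets: "sets P = sets borel"
  shows "iid_from (iid_law P) (\<lambda>i x. x i) P"
proof -
  interpret P: prob_space P by fact
  interpret Q: prob_space "iid_law P"
    unfolding iid_law_def by (intro prob_space_PiM assms)
  have rv: "(\<lambda>x. x i) \<in> borel_measurable (iid_law P)" if "i \<ge> 1" for i
    unfolding iid_law_def using that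
    by (subst measurable_cong_sets[OF refl sets[symmetric]]) measurable
  have distr: "distr (iid_law P) borel (\<lambda>x. x i) = P" if "i \<ge> 1" for i
  proof -
    have "distr (iid_law P) borel (\<lambda>x. x i) = distr (iid_law P) P (\<lambda>x. x i)"
      by (intro distr_cong) (auto simp: sets)
    also have "\<dots> = P"
      unfolding iid_law_def using that by (intro distr_PiM_component assms) auto
    finally show ?thesis .
  qed
  \<comment> \<open>Independence is shown by identifying the joint law with the product of the
    marginals. Points of the product space are extensional on \<open>{1..}\<close>, so the joint map
    is the identity there.\<close>
  have "distr (iid_law P) (Pi\<^sub>M {1..} (\<lambda>_. borel)) (\<lambda>x. \<lambda>i\<in>{1..}. x i)
      = distr (iid_law P) (iid_law P) (\<lambda>x. x)"
    unfolding iid_law_def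
    by (intro distr_cong sets_PiM_cong) (auto simp: sets space_PiM PiE_def extensional_restrict)
  also have "\<dots> = (Pi\<^sub>M {1..} (\<lambda>i. distr (iid_law P) borel (\<lambda>x. x i)))"
    unfolding iid_law_def[symmetric] distr_id
    by (subst iid_law_def, rule PiM_cong) (simp_all add: distr)
  finally have "Q.indep_vars (\<lambda>_. borel) (\<lambda>i x. x i) {1..}"
    using rv by (subst Q.indep_vars_iff_distr_eq_PiM') auto
  thus ?thesis
    using distr by (simp add: iid_from_def Q.prob_space_axioms)
qed

theorem theorem2:
  fixes \<mu> m \<alpha> c :: real
  assumes "\<mu> \<in> {0..1}" and "m \<in> {0..1}" and "m \<noteq> \<mu>"
    and "\<alpha> \<in> {0<..<1}" and "c > 1 / 4"
  shows "(\<forall>P\<in>mean_dists \<mu>. \<forall>(M :: 'a measure) X. iid_from M X P \<longrightarrow>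
           (AE \<omega> in M. filterlim (\<lambda>t. capital c m (\<lambda>i. X i \<omega>) t) at_top sequentially)) \<and>
         (INF P\<in>mean_dists \<mu>. measure (iid_law P)
           {x \<in> space (iid_law P). \<exists>t. seq_test c m \<alpha> x t = 1}) = 1"
proof (intro conjI ballI allI impI)
  fix P :: "real measure" and M :: "'a measure" and X
  assume "P \<in> mean_dists \<mu>" "iid_from M X P"
  thus "AE \<omega> in M. filterlim (\<lambda>t. capital c m (\<lambda>i. X i \<omega>) t) at_top sequentially"
    using iid_capital_at_top assms by blast
next
  have "measure (iid_law P) {x \<in> space (iid_law P). \<exists>t. seq_test c m \<alpha> x t = 1} = 1"
    if P: "P \<in> mean_dists \<mu>" for P
  proof -
    have "prob_space P" and sets: "sets P = sets borel"
      using P by (auto simp: mean_dists_def)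
    hence iid: "iid_from (iid_law P) (\<lambda>i x. x i) P"
      by (rule iid_from_iid_law)
    then interpret Q: prob_space "iid_law P"
      by (simp add: iid_from_def)
    have rv: "(\<lambda>x. x i) \<in> borel_measurable (iid_law P)" if "i \<ge> 1" for i
      using iid that by (auto simp: iid_from_def Q.indep_vars_def)
    have "(\<lambda>x. mu_hat m x n) \<in> borel_measurable (iid_law P)" for n
      unfolding mu_hat_def using rv by (cases "n = 0") auto
    hence [measurable]: "(\<lambda>x. capital c m x t) \<in> borel_measurable (iid_law P)" for t
      unfolding capital_def using rv
      by (intro borel_measurable_prod borel_measurable_add borel_measurable_divide
          borel_measurable_times borel_measurable_diff) auto
    have "{x \<in> space (iid_law P). \<exists>t. seq_test c m \<alpha> x t = 1} \<in> sets (iid_law P)"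
      unfolding seq_test_def of_bool_eq_1_iff by measurable
    moreover have "AE x in iid_law P. \<exists>t. seq_test c m \<alpha> x t = 1"
      using iid_capital_at_top[OF assms(1-3,5) P iid]
    proof eventually_elim
      case (elim x)
      hence "\<forall>\<^sub>F t in sequentially. capital c m x t \<ge> 1 / \<alpha>"
        by (simp add: filterlim_at_top)
      then obtain t where "capital c m x t \<ge> 1 / \<alpha>"
        by (auto simp: eventually_sequentially)
      hence "seq_test c m \<alpha> x t = 1"
        by (auto simp: seq_test_def)
      thus ?case ..
    qed
    ultimately show ?thesis
      by (simp add: Q.prob_Collect_eq_1)
  qed
  \<comment> \<open>Every \<open>P\<close> gives the event probability exactly 1, so the infimum is
    over a constant family; the point mass at \<open>\<mu>\<close> shows that this family is
    nonempty.\<close>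
  moreover have "return borel \<mu> \<in> mean_dists \<mu>"
    using assms(1)
    by (simp add: mean_dists_def prob_space_return integral_return measure_return)
  hence "mean_dists \<mu> \<noteq> {}" by blast
  ultimately show "(INF P\<in>mean_dists \<mu>. measure (iid_law P)
      {x \<in> space (iid_law P). \<exists>t. seq_test c m \<alpha> x t = 1}) = 1"
    by simp
qed

end
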